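(* Let $m\ge0$. A level $m$ bandlimited function $u$ on $SG$ is uniquely determined by $A_m(u)$, and it is also uniquely determined by $B_m(u)$. That is, if $u$ and $v$ are level $m$ bandlimited functions on $SG$ with $A_m(u)=A_m(v)$, then $u=v$; and if $u$ and $v$ are level $m$ bandlimited functions on $SG$ with $B_m(u)=B_m(v)$, then $u=v$.
   Context: Let $q_0=(0,0)$, $q_1=(\tfrac12,\tfrac{\sqrt3}{2})$, $q_2=(1,0)$ and $F_i(x)=\tfrac12(x-q_i)+q_i$ for $i=0,1,2$. The Sierpinski gasket $SG$ is the unique nonempty compact subset of $\mathbb{R}^2$ with $SG=\bigcup_{i=0}^2F_i(SG)$. For a word $w=(w_1,\dots,w_m)\in\{0,1,2\}^m$ put $F_w=F_{w_m}\circ\cdots\circ F_{w_1}$. An $m$-cell of $SG$ is a set $F_w(SG)$ with $w$ of length $m$; its boundary points are $F_wq_0,F_wq_1,F_wq_2$. There are $3^m$ $m$-cells, and $\mu$ is the Borel probability measure on $SG$ giving each $m$-cell measure $3^{-m}$ (for all $m$). Vertex graphs. $V_0=\{q_0,q_1,q_2\}$, $V_m=\bigcup_{i=0}^2F_i(V_{m-1})$ for $m\geq 1$, and $\beta_m$ is the graph with vertex set $V_m$ in which distinct $x,y$ are joined by an edge ($x\sim y$) iff they are boundary points of a common $m$-cell. A Neumann eigenfunction on $\beta_m$ with eigenvalue $\lambda$ is a function $u:V_m\to\mathbb{R}$, not identically zero, with $\sum_{y\sim x}(u(x)-u(y))=\lambda u(x)$ for all $x\in V_m\setminus V_0$, and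 $(4-\lambda)u(q_i)=2\sum_{y\sim q_i}u(y)$ for $i=0,1,2$ (each $q_i$ has exactly two neighbours). The Neumann eigenfunctions span the space of all functions on $V_m$, which has dimension $\frac{3^{m+1}+3}{2}$; the eigenvalue $6$ is the largest one and has multiplicity $\frac{3^m+3}{2}$. Spectral decimation. Let $u$ be a Neumann eigenfunction on $\beta_{n-1}$ with eigenvalue $\lambda_{n-1}$, and let $\lambda_n\notin\{2,5,6\}$ satisfy $\lambda_{n-1}=\lambda_n(5-\lambda_n)$, i.e. $\lambda_n=\frac{5+\varepsilon_n\sqrt{25-4\lambda_{n-1}}}{2}$ with $\varepsilon_n=\pm1$. The continuation of $u$ to $\beta_n$ with eigenvalue $\lambda_n$ is the function $u'$ on $V_n$ with $u'=u$ on $V_{n-1}$ and, for each $(n-1)$-cell with boundary points $x,y,z$ and with $p\in V_n$ the midpoint of $x$ and $y$, $$u'(p)=\frac{(4-\lambda_n)(u(x)+u(y))+2u(z)}{(2-\lambda_n)(5-\lambda_n)}$$ (and likewise for the other two midpoints). It is known that $u'$ is a Neumann eigenfunction on $\beta_n$ with eigenvalue $\lambda_n$. First $3^m$ elements of the Neumann eigenbasis of $SG$. Take a basis, consisting of Neumann eigenfunctions, of the span of those Neumann eigenfunctions on $\beta_m$ whose eigenvalue is not $6$ (this span has dimension $3^m$). Continue each basis element successively to $\beta_n$ for all $n>m$ by spectral decimation, always with the choice $\varepsilon_n=-1$, and extend the resulting function from $\bigcup_nV_n$ to $SG$ by continuity (it is known that this is possible and gives a Neumann eigenfunction of the Laplacian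 on $SG$). The resulting $3^m$ continuous functions on $SG$ are called the first $3^m$ elements of the Neumann eigenbasis of $SG$. A level $m$ bandlimited function on $SG$ is a (real) linear combination of these $3^m$ functions. Averages. For an $m$-cell $C=F_w(SG)$ and a continuous $u:SG\to\mathbb{R}$, put $A_C(u)=\frac13\sum_{i=0}^2u(F_wq_i)$ and $B_C(u)=3^m\int_Cu\,d\mu$. Then $A_m(u)$ and $B_m(u)$ are the functions on the set of $m$-cells given by $A_m(u)(C)=A_C(u)$ and $B_m(u)(C)=B_C(u)$. *)

theory Defs
  imports "HOL-Probability.Probability" "HOL-Library.Function_Algebras"
begin

text \<open>
  Functions on a subset \<open>X\<close> of the plane are represented as total functions vanishing
  outside \<open>X\<close>, so that they form a real vector space and equality of functions on \<open>X\<close> is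
  plain equality. The pointwise vector space structure below makes \<^const>\<open>span\<close> and
  \<^const>\<open>independent\<close> available for sets of functions.
\<close>

instantiation "fun" :: (type, real_vector) real_vector
begin

definition scaleR_fun :: "real \<Rightarrow> ('a \<Rightarrow> 'b) \<Rightarrow> 'a \<Rightarrow> 'b" where
  "scaleR_fun c f = (\<lambda>x. c *\<^sub>R f x)"

instance
  by standard (simp_all add: scaleR_fun_def fun_eq_iff scaleR_add_right scaleR_add_left)

end

lemma scaleR_fun_apply [simp]: "(c *\<^sub>R f) x = c *\<^sub>R f x"
  by (simp add: scaleR_fun_def)

section \<open>The Sierpinski gasket\<close>

type_synonym plane = "real \<times> real"

text \<open>Only the indices 0, 1, 2 are used.\<close>

definition sg_q :: "nat \<Rightarrow> plane" where
  "sg_q i = (if i = 0 then (0, 0) else if i = 1 then (1/2, sqrt 3 / 2) else (1, 0))"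

definition sg_F :: "nat \<Rightarrow> plane \<Rightarrow> plane" where
  "sg_F i x = (1/2) *\<^sub>R (x - sg_q i) + sg_q i"

definition SG :: "plane set" where
  "SG = (THE K. compact K \<and> K \<noteq> {} \<and> K = (\<Union>i\<in>{0,1,2}. sg_F i ` K))"

definition sg_words :: "nat \<Rightarrow> nat list set" where
  "sg_words m = {w. length w = m \<and> set w \<subseteq> {0,1,2}}"

text \<open>\<^const>\<open>fold\<close> applies the first letter first: \<open>sg_Fw [i, j] x = sg_F j (sg_F i x)\<close>.\<close>

definition sg_Fw :: "nat list \<Rightarrow> plane \<Rightarrow> plane" where
  "sg_Fw w = fold sg_F w"

definition sg_cell :: "nat list \<Rightarrow> plane set" where
  "sg_cell w = sg_Fw w ` SG"

definition sg_measure :: "plane measure \<Rightarrow> bool" where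
  "sg_measure \<mu> \<longleftrightarrow>
     prob_space \<mu> \<and> sets \<mu> = sets (restrict_space borel SG) \<and>
     (\<forall>m. \<forall>w\<in>sg_words m. measure \<mu> (sg_cell w) = 1 / 3 ^ m)"

section \<open>Vertex graphs and Neumann eigenfunctions\<close>

fun sg_V :: "nat \<Rightarrow> plane set" where
  "sg_V 0 = sg_q ` {0,1,2}"
| "sg_V (Suc m) = (\<Union>i\<in>{0,1,2}. sg_F i ` sg_V m)"

definition sg_adj :: "nat \<Rightarrow> plane \<Rightarrow> plane \<Rightarrow> bool" where
  "sg_adj m x y \<longleftrightarrow>
     x \<noteq> y \<and> (\<exists>w\<in>sg_words m. x \<in> sg_Fw w ` sg_q ` {0,1,2} \<and> y \<in> sg_Fw w ` sg_q ` {0,1,2})"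

definition neumann_eigenfunction :: "nat \<Rightarrow> real \<Rightarrow> (plane \<Rightarrow> real) \<Rightarrow> bool" where
  "neumann_eigenfunction m lam u \<longleftrightarrow>
     (\<forall>x. x \<notin> sg_V m \<longrightarrow> u x = 0) \<and>
     (\<exists>x\<in>sg_V m. u x \<noteq> 0) \<and>
     (\<forall>x\<in>sg_V m - sg_V 0. (\<Sum>y | sg_adj m x y. u x - u y) = lam * u x) \<and>
     (\<forall>i\<in>{0,1,2}. (4 - lam) * u (sg_q i) = 2 * (\<Sum>y | sg_adj m (sg_q i) y. u y))"

section \<open>Spectral decimation\<close>

text \<open>
  \<open>sg_continuation n lam u lam' u'\<close>: the function \<open>u'\<close> on level \<open>n + 1\<close> is the continuation
  with eigenvalue \<open>lam'\<close> of the eigenfunction \<open>u\<close> on level \<open>n\<close> with eigenvalue \<open>lam\<close>.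
  The condition on \<open>i, j, k\<close> says that they are 0, 1, 2 in some order.
\<close>

definition sg_continuation ::
    "nat \<Rightarrow> real \<Rightarrow> (plane \<Rightarrow> real) \<Rightarrow> real \<Rightarrow> (plane \<Rightarrow> real) \<Rightarrow> bool" where
  "sg_continuation n lam u lam' u' \<longleftrightarrow>
     lam' \<notin> {2, 5, 6} \<and> lam = lam' * (5 - lam') \<and>
     (\<forall>x. x \<notin> sg_V (Suc n) \<longrightarrow> u' x = 0) \<and>
     (\<forall>x\<in>sg_V n. u' x = u x) \<and>
     (\<forall>w\<in>sg_words n. \<forall>i j k. {i, j, k} = {0, 1, 2} \<longrightarrow>
        (let x = sg_Fw w (sg_q i); y = sg_Fw w (sg_q j); z = sg_Fw w (sg_q k) in
         u' (midpoint x y) =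
           ((4 - lam') * (u x + u y) + 2 * u z) / ((2 - lam') * (5 - lam'))))"

text \<open>
  \<open>decimation_extension m lam u f\<close>: \<open>f\<close> is the continuous function on the gasket obtained
  from the level \<open>m\<close> eigenfunction \<open>u\<close> with eigenvalue \<open>lam\<close> by always choosing the smaller
  root \<open>(5 - sqrt (25 - 4 * lam)) / 2\<close>.
\<close>

definition decimation_extension ::
    "nat \<Rightarrow> real \<Rightarrow> (plane \<Rightarrow> real) \<Rightarrow> (plane \<Rightarrow> real) \<Rightarrow> bool" where
  "decimation_extension m lam u f \<longleftrightarrow>
     (\<exists>l us. l m = lam \<and> us m = u \<and>
        (\<forall>n\<ge>m. l (Suc n) = (5 - sqrt (25 - 4 * l n)) / 2 \<and>
                sg_continuation n (l n) (us n) (l (Suc n)) (us (Suc n))) \<and>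
        (\<forall>n\<ge>m. \<forall>x\<in>sg_V n. f x = us n x)) \<and>
     continuous_on SG f \<and> (\<forall>x. x \<notin> SG \<longrightarrow> f x = 0)"

text \<open>
  \<open>initial_eigenbasis m E\<close>: \<open>E\<close> consists of the first \<open>3 ^ m\<close> elements of the Neumann
  eigenbasis, for some choice of the basis \<open>B\<close> of eigenfunctions on level \<open>m\<close>.
\<close>

definition initial_eigenbasis :: "nat \<Rightarrow> (plane \<Rightarrow> real) set \<Rightarrow> bool" where
  "initial_eigenbasis m E \<longleftrightarrow>
     (\<exists>B ext.
        B \<subseteq> {u. \<exists>lam. lam \<noteq> 6 \<and> neumann_eigenfunction m lam u} \<and>
        independent B \<and>
        span B = span {u. \<exists>lam. lam \<noteq> 6 \<and> neumann_eigenfunction m lam u} \<and>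
        (\<forall>u\<in>B. \<exists>lam. lam \<noteq> 6 \<and> neumann_eigenfunction m lam u \<and>
                decimation_extension m lam u (ext u)) \<and>
        E = ext ` B)"

definition bandlimited :: "(plane \<Rightarrow> real) set \<Rightarrow> (plane \<Rightarrow> real) \<Rightarrow> bool" where
  "bandlimited E u \<longleftrightarrow> u \<in> span E"

section \<open>Averages over cells\<close>

text \<open>The \<open>m\<close>-cells are indexed by the words of length \<open>m\<close>; distinct words give distinct cells.\<close>

definition boundary_average :: "nat \<Rightarrow> (plane \<Rightarrow> real) \<Rightarrow> nat list \<Rightarrow> real" where
  "boundary_average m u = (\<lambda>w\<in>sg_words m. (1/3) * (\<Sum>i\<in>{0,1,2}. u (sg_Fw w (sg_q i))))"

definition integral_average :: "plane measure \<Rightarrow> nat \<Rightarrow> (plane \<Rightarrow> real) \<Rightarrow> nat list \<Rightarrow> real" where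
  "integral_average \<mu> m u = (\<lambda>w\<in>sg_words m. 3 ^ m * (LINT x : sg_cell w | \<mu>. u x))"

section \<open>The gasket is well defined\<close>

lemma dist_sg_F: "dist (sg_F i x) (sg_F i y) = dist x y / 2"
proof -
  have "sg_F i x - sg_F i y = (1/2) *\<^sub>R (x - y)"
    by (simp add: sg_F_def algebra_simps)
  then show ?thesis by (simp add: dist_norm)
qed

lemma continuous_sg_F: "continuous_on S (sg_F i)"
  unfolding sg_F_def by (intro continuous_intros)

lemma sg_fixed_subset:
  assumes K: "compact K" "K \<noteq> {}" "K = (\<Union>i\<in>{0,1,2}. sg_F i ` K)"
    and L: "compact L" "L \<noteq> {}" "L = (\<Union>i\<in>{0,1,2}. sg_F i ` L)"
  shows "K \<subseteq> L"
proof -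
  have "continuous_on K (\<lambda>x. infdist x L)" by (intro continuous_intros)
  from continuous_attains_sup[OF K(1,2) this] obtain a
    where a: "a \<in> K" "\<And>x. x \<in> K \<Longrightarrow> infdist x L \<le> infdist a L" by blast
  obtain i b where ib: "i \<in> {0,1,2}" "b \<in> K" "a = sg_F i b" using a(1) K(3) by blast
  obtain c where c: "c \<in> L" "infdist b L = dist b c"
    using infdist_attains_inf[of L b] compact_imp_closed[OF L(1)] L(2) by blast
  have "sg_F i c \<in> L" using L(3) ib(1) c(1) by blast
  then have "infdist a L \<le> dist b c / 2"
    using infdist_le[of "sg_F i c" L a] ib(3) by (simp add: dist_sg_F)
  with a(2)[OF ib(2)] c(2) have "infdist a L \<le> 0" by linarith
  then have "infdist x L = 0" if "x \<in> K" for x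
    using a(2)[OF that] infdist_nonneg[of x L] by linarith
  then show ?thesis
    using in_closed_iff_infdist_zero[OF compact_imp_closed[OF L(1)] L(2)] by blast
qed

lemma sg_V_subset_Suc: "sg_V m \<subseteq> sg_V (Suc m)"
proof (induction m)
  case 0
  have "sg_F i (sg_q i) = sg_q i" for i by (simp add: sg_F_def)
  then show ?case by (auto intro!: rev_image_eqI)
next
  case (Suc m)
  then have "(\<Union>i\<in>{0,1,2}. sg_F i ` sg_V m) \<subseteq> (\<Union>i\<in>{0,1,2}. sg_F i ` sg_V (Suc m))"
    by blast
  then show ?case by (simp only: sg_V.simps)
qed

lemma norm_sg_q: "norm (sg_q i) \<le> 1"
  by (simp add: sg_q_def norm_Pair power_divide)

lemma sg_V_bounded: "sg_V m \<subseteq> cball 0 1"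
proof (induction m)
  case 0
  then show ?case using norm_sg_q by auto
next
  case (Suc m)
  have "norm (sg_F i x) \<le> 1" if "norm x \<le> 1" for i x
  proof -
    have "sg_F i x = (1/2) *\<^sub>R x + (1/2) *\<^sub>R sg_q i"
      by (simp add: sg_F_def algebra_simps flip: scaleR_add_left)
    then show ?thesis
      using norm_triangle_ineq[of "(1/2) *\<^sub>R x" "(1/2) *\<^sub>R sg_q i"] that norm_sg_q[of i] by simp
  qed
  with Suc show ?case by fastforce
qed

lemma SG_ex1: "\<exists>!K. compact K \<and> K \<noteq> {} \<and> K = (\<Union>i\<in>{0,1,2}. sg_F i ` K)"
proof (rule ex_ex1I)
  define W where "W = (\<Union>m. sg_V m)"
  have "bounded W"
    unfolding W_def by (rule bounded_subset[of "cball 0 1"]) (use sg_V_bounded in auto)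
  then have comp: "compact (closure W)" by (simp add: compact_closure)
  have W: "W = (\<Union>i\<in>{0,1,2}. sg_F i ` W)"
  proof -
    have "W = (\<Union>m. sg_V (Suc m))"
      unfolding W_def using sg_V_subset_Suc by blast
    also have "\<dots> = (\<Union>i\<in>{0,1,2}. sg_F i ` W)"
      unfolding W_def sg_V.simps by blast
    finally show ?thesis .
  qed
  have cl: "sg_F i ` closure W = closure (sg_F i ` W)" for i
  proof
    show "sg_F i ` closure W \<subseteq> closure (sg_F i ` W)"
      by (rule image_closure_subset) (simp_all add: continuous_sg_F closure_subset)
    have "closed (sg_F i ` closure W)"
      using compact_continuous_image[OF continuous_sg_F comp] compact_imp_closed by blast
    then show "closure (sg_F i ` W) \<subseteq> sg_F i ` closure W"
      by (intro closure_minimal image_mono closure_subset)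
  qed
  have "closure W = (\<Union>i\<in>{0,1,2}. sg_F i ` closure W)"
    by (subst W) (simp add: cl)
  moreover have "sg_q 0 \<in> W" unfolding W_def by (rule UN_I[of 0]) auto
  then have "closure W \<noteq> {}" using closure_subset by blast
  ultimately show "\<exists>K. compact K \<and> K \<noteq> {} \<and> K = (\<Union>i\<in>{0,1,2}. sg_F i ` K)"
    using comp by blast
next
  fix K L
  assume "compact K \<and> K \<noteq> {} \<and> K = (\<Union>i\<in>{0,1,2}. sg_F i ` K)"
    and "compact L \<and> L \<noteq> {} \<and> L = (\<Union>i\<in>{0,1,2}. sg_F i ` L)"
  then show "K = L" using sg_fixed_subset by (metis subset_antisym)
qed

lemma SG_props: "compact SG" "SG \<noteq> {}" "SG = (\<Union>i\<in>{0,1,2}. sg_F i ` SG)"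
  using theI'[OF SG_ex1] unfolding SG_def by blast+

end

theory Submission
  imports Defs
begin

text \<open>
  Write \<open>S\<^sub>C u\<close> for the sum of a function over the three corners of a cell \<open>C\<close>. Two cells of the
  same level share at most one vertex, a vertex of \<open>V\<^sub>m\<close> outside \<open>V\<^sub>0\<close> lies in exactly two
  \<open>m\<close>-cells, and a point of \<open>V\<^sub>0\<close> lies in exactly one (lemma \<open>card_cells_at\<close>). The sum over the
  neighbours of \<open>x\<close> is therefore a sum of cell sums minus a multiple of \<open>u x\<close>, and the eigenvalue
  equation at level \<open>m\<close>, including the boundary condition, says that \<open>(6 - \<lambda>) u x\<close> is twice the mean
  of \<open>S\<^sub>C u\<close> over the \<open>m\<close>-cells \<open>C\<close> at \<open>x\<close> (lemma \<open>neumann_eigenfunction_cell_sums\<close>). Thus the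
  linear operator \<open>M\<close> that sends \<open>u\<close> to twice these means is diagonal on the eigenfunctions, has nonzero
  eigenvalues \<open>6 - \<lambda>\<close> on those in the basis, and depends on cell sums only: a combination of basis
  elements with vanishing cell sums is killed by \<open>M\<close>, and so has zero coefficients. This settles
  the averages \<open>A\<^sub>m\<close>.

  The averages \<open>B\<^sub>m\<close> reduce to \<open>A\<^sub>m\<close>. For the continuation of an
  eigenfunction to the next level with eigenvalue \<open>\<lambda>'\<close>, the mean of the corner averages over the
  three subcells of a cell is the corner average over the cell times \<open>(6 - \<lambda>') / (3 (2 - \<lambda>'))\<close>, a
  factor that does not depend on the cell. For the smaller root the
  eigenvalues shrink geometrically, so the infinite product \<open>\<gamma>\<close> of these factors converges to a
  nonzero number. Since means over fine subcells converge to the integral, the integral average of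
  a basis element over any \<open>m\<close>-cell is \<open>\<gamma>\<close> times its corner average there, with \<open>\<gamma>\<close> depending only
  on the basis element. A combination with coefficients \<open>c\<^sub>b\<close> and zero integrals hence yields a
  combination with coefficients \<open>c\<^sub>b \<gamma>\<^sub>b\<close> and zero cell sums, and these coefficients vanish by the
  first part.
\<close>

section \<open>Words and cells\<close>

lemma sg_Fw_Nil [simp]: "sg_Fw [] x = x"
  by (simp add: sg_Fw_def)

lemma sg_Fw_Cons [simp]: "sg_Fw (i # w) x = sg_Fw w (sg_F i x)"
  by (simp add: sg_Fw_def)

lemma sg_Fw_append [simp]: "sg_Fw (v @ w) x = sg_Fw w (sg_Fw v x)"
  by (simp add: sg_Fw_def)

lemma sg_words_0 [simp]: "sg_words 0 = {[]}"
  by (auto simp: sg_words_def)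

lemma sg_words_Suc: "sg_words (Suc m) = (\<lambda>(i, w). i # w) ` ({0,1,2} \<times> sg_words m)"
  by (fastforce simp: sg_words_def length_Suc_conv image_iff)

lemma sg_words_snoc: "sg_words (Suc m) = (\<Union>i\<in>{0,1,2}. (\<lambda>w. w @ [i]) ` sg_words m)"
  by (fastforce simp: sg_words_def length_Suc_conv_rev image_iff)

lemma sg_words_append: "v \<in> sg_words k \<Longrightarrow> w \<in> sg_words m \<Longrightarrow> v @ w \<in> sg_words (m + k)"
  by (auto simp: sg_words_def)

lemma finite_sg_words [simp]: "finite (sg_words m)"
  using finite_lists_length_eq[of "{0,1,2::nat}" m] by (simp add: sg_words_def conj_commute)

lemma card_sg_words: "card (sg_words m) = 3 ^ m"
proof -
  have "card {0,1,2::nat} = 3" by simp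
  then show ?thesis
    using card_lists_length_eq[of "{0,1,2::nat}" m]
    by (simp only: sg_words_def conj_commute) simp
qed

lemma dist_sg_Fw: "dist (sg_Fw w x) (sg_Fw w y) = dist x y / 2 ^ length w"
  by (induction w arbitrary: x y) (simp_all add: dist_sg_F)

lemma inj_sg_Fw: "inj (sg_Fw w)"
proof (rule injI)
  fix x y assume "sg_Fw w x = sg_Fw w y"
  then show "x = y" using dist_sg_Fw[of w x y] by simp
qed

lemma sg_Fw_midpoint: "sg_Fw w (midpoint x y) = midpoint (sg_Fw w x) (sg_Fw w y)"
proof (induction w arbitrary: x y)
  case (Cons i w)
  have "sg_F i (midpoint x y) = midpoint (sg_F i x) (sg_F i y)"
    by (simp add: sg_F_def midpoint_def algebra_simps flip: scaleR_add_left)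
  then show ?case by (simp add: Cons)
qed simp

lemma sg_F_q: "sg_F i (sg_q j) = midpoint (sg_q i) (sg_q j)"
proof -
  have "sg_F i (sg_q j) = (1/2) *\<^sub>R sg_q j + (sg_q i - (1/2) *\<^sub>R sg_q i)"
    by (simp add: sg_F_def algebra_simps)
  also have "sg_q i - (1/2) *\<^sub>R sg_q i = (1/2) *\<^sub>R sg_q i"
    by (metis add_diff_cancel_right' field_sum_of_halves scaleR_add_left scaleR_one)
  finally show ?thesis by (simp add: midpoint_def algebra_simps)
qed

section \<open>Barycentric coordinates and the cells at a vertex\<close>

text \<open>
  The three affine coordinates of the plane with respect to the corners \<open>q\<^sub>0\<close>, \<open>q\<^sub>1\<close>, \<open>q\<^sub>2\<close>, all
  nonnegative on the triangle. They turn the separation of the three copies of the gasket into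
  linear arithmetic, because on the copy \<open>F\<^sub>i\<close> the \<open>i\<close>-th coordinate is at least \<open>1/2\<close>.
\<close>

definition bary :: "nat \<Rightarrow> plane \<Rightarrow> real" where
  "bary i x = (if i = 0 then 1 - fst x - snd x / sqrt 3
               else if i = 1 then 2 * snd x / sqrt 3 else fst x - snd x / sqrt 3)"

lemma bary_q: "i \<in> {0,1,2} \<Longrightarrow> j \<in> {0,1,2} \<Longrightarrow> bary i (sg_q j) = (if i = j then 1 else 0)"
  by (auto simp: bary_def sg_q_def)

lemma bary_sum: "bary 0 x + bary 1 x + bary 2 x = 1"
  by (simp add: bary_def)

lemma bary_eqI:
  assumes "\<And>i. i \<in> {0,1,2} \<Longrightarrow> bary i x = bary i y"
  shows "x = y"
  using assms[of 1] assms[of 2] by (simp add: bary_def prod_eq_iff)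

text \<open>The inverse of \<^term>\<open>sg_F i\<close>.\<close>

definition unfold_F :: "nat \<Rightarrow> plane \<Rightarrow> plane" where
  "unfold_F i x = 2 *\<^sub>R x - sg_q i"

lemma sg_F_eq_iff: "sg_F i y = x \<longleftrightarrow> y = unfold_F i x"
  by (auto simp: sg_F_def unfold_F_def prod_eq_iff field_simps)

lemma bary_unfold_F:
  "i \<in> {0,1,2} \<Longrightarrow> j \<in> {0,1,2} \<Longrightarrow>
    bary i (unfold_F j x) = 2 * bary i x - (if i = j then 1 else 0)"
  by (auto simp: bary_def unfold_F_def sg_q_def field_simps)

definition vertices :: "nat list \<Rightarrow> plane set" where
  "vertices w = sg_Fw w ` sg_q ` {0,1,2}"

lemma mem_vertices_snoc: "x \<in> vertices (w @ [i]) \<longleftrightarrow> unfold_F i x \<in> vertices w"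
proof -
  have "vertices (w @ [i]) = sg_F i ` vertices w"
    by (simp add: vertices_def)
  then show ?thesis using sg_F_eq_iff[of i _ x] by (metis image_iff)
qed

lemma sg_V_eq_Union_vertices: "sg_V m = (\<Union>w\<in>sg_words m. vertices w)"
proof (induction m)
  case (Suc m)
  have "vertices (w @ [i]) = sg_F i ` vertices w" for w i
    by (simp add: vertices_def)
  with Suc show ?case by (simp add: sg_words_snoc image_UN)
qed (simp add: vertices_def)

lemma mem_sg_V_Suc: "x \<in> sg_V (Suc m) \<longleftrightarrow> (\<exists>i\<in>{0,1,2}. unfold_F i x \<in> sg_V m)"
  unfolding sg_V.simps UN_iff image_iff using sg_F_eq_iff[of _ _ x] by metis

lemma bary_nonneg:
  assumes "x \<in> sg_V m" "i \<in> {0,1,2}"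
  shows "bary i x \<ge> 0"
  using assms
proof (induction m arbitrary: x)
  case 0
  then show ?case using bary_q by fastforce
next
  case (Suc m)
  then obtain j where "j \<in> {0,1,2}" "unfold_F j x \<in> sg_V m"
    using mem_sg_V_Suc by blast
  with Suc.IH[of "unfold_F j x"] Suc.prems(2) show ?case
    by (auto simp: bary_unfold_F split: if_splits)
qed

text \<open>A point of both \<open>F\<^sub>i\<close> and \<open>F\<^sub>j\<close> of the triangle has its \<open>i\<close>-th and \<open>j\<close>-th barycentric coordinate
  at least \<open>1/2\<close>. As the coordinates are nonnegative with sum 1, it is the midpoint of \<open>q\<^sub>i\<close> and \<open>q\<^sub>j\<close>.\<close>

lemma unfold_F_both:
  assumes ij: "i \<in> {0,1,2}" "j \<in> {0,1,2}" "i \<noteq> j"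
    and x: "unfold_F i x \<in> sg_V m" "unfold_F j x \<in> sg_V m"
  shows "unfold_F i x = sg_q j"
proof (rule bary_eqI)
  have nonneg: "2 * bary k x \<ge> (if k = i \<or> k = j then 1 else 0)" if "k \<in> {0,1,2}" for k
    using bary_nonneg[OF x(1) that] bary_nonneg[OF x(2) that] ij that
    by (auto simp: bary_unfold_F split: if_splits)
  fix k assume k: "k \<in> {0,1,2::nat}"
  show "bary k (unfold_F i x) = bary k (sg_q j)"
    using nonneg[of 0] nonneg[of 1] nonneg[of 2] bary_sum[of x] ij k
    by (auto simp: bary_unfold_F bary_q)
qed

text \<open>Compare the last letters, which select the outermost map: equal letters can be stripped, and cells
  in different first-level copies of the gasket meet at most in the common point of the two copies.\<close>

lemma vertices_inter_subsingleton:
  assumes "w \<in> sg_words m" "w' \<in> sg_words m" "x \<noteq> y"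
    and "x \<in> vertices w" "y \<in> vertices w" "x \<in> vertices w'" "y \<in> vertices w'"
  shows "w = w'"
  using assms
proof (induction m arbitrary: w w' x y)
  case (Suc m)
  obtain v i where v: "w = v @ [i]" "i \<in> {0,1,2}" "v \<in> sg_words m"
    using Suc.prems(1) unfolding sg_words_snoc by blast
  obtain v' i' where v': "w' = v' @ [i']" "i' \<in> {0,1,2}" "v' \<in> sg_words m"
    using Suc.prems(2) unfolding sg_words_snoc by blast
  have neq: "unfold_F i x \<noteq> unfold_F i y"
    using Suc.prems(3) by (simp add: unfold_F_def)
  have mem: "unfold_F i x \<in> vertices v" "unfold_F i y \<in> vertices v"
    "unfold_F i' x \<in> vertices v'" "unfold_F i' y \<in> vertices v'"
    using Suc.prems v v' by (simp_all add: mem_vertices_snoc)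
  show ?case
  proof (cases "i = i'")
    case True
    then show ?thesis using Suc.IH[OF v(3) v'(3) neq] mem v v' by simp
  next
    case False
    have "unfold_F i x = sg_q i'" "unfold_F i y = sg_q i'"
      by (rule unfold_F_both[OF v(2) v'(2) False, of _ m];
          use mem v v' in \<open>auto simp: sg_V_eq_Union_vertices\<close>)+
    with neq show ?thesis by simp
  qed
qed auto

definition cells_at :: "nat \<Rightarrow> plane \<Rightarrow> nat list set" where
  "cells_at m x = {w \<in> sg_words m. x \<in> vertices w}"

lemma finite_cells_at [simp]: "finite (cells_at m x)"
  by (simp add: cells_at_def)

lemma cells_at_empty: "x \<notin> sg_V m \<Longrightarrow> cells_at m x = {}"
  by (auto simp: cells_at_def sg_V_eq_Union_vertices)

text \<open>The cells of level \<open>m + 1\<close> at \<open>x\<close> are the images under the three maps of the cells of level \<open>m\<close>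
  at the preimages of \<open>x\<close>, which makes the count accessible to induction.\<close>

lemma card_cells_at_Suc:
  "card (cells_at (Suc m) x) = (\<Sum>i\<in>{0,1,2}. card (cells_at m (unfold_F i x)))"
proof -
  have "cells_at (Suc m) x = (\<Union>i\<in>{0,1,2}. (\<lambda>w. w @ [i]) ` cells_at m (unfold_F i x))"
    unfolding cells_at_def sg_words_snoc by (auto simp: mem_vertices_snoc)
  also have "card \<dots> = (\<Sum>i\<in>{0,1,2}. card ((\<lambda>w. w @ [i]) ` cells_at m (unfold_F i x)))"
    by (rule card_UN_disjoint) auto
  also have "\<dots> = (\<Sum>i\<in>{0,1,2}. card (cells_at m (unfold_F i x)))"
    by (intro sum.cong refl card_image) (simp add: inj_on_def)
  finally show ?thesis .
qed

text \<open>A corner \<open>q\<^sub>j\<close> lies in the copy \<open>F\<^sub>j\<close> only, where it is again a corner. The midpoint of \<open>q\<^sub>i\<close> and \<open>q\<^sub>j\<close>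
  is a corner of both copies \<open>F\<^sub>i\<close> and \<open>F\<^sub>j\<close>, and gets one cell from each.
  Any other vertex lies in a single copy and is not a corner there, so induction gives two cells.\<close>

lemma card_cells_at:
  "card (cells_at m x) = (if x \<in> sg_V 0 then 1 else if x \<in> sg_V m then 2 else 0)"
proof (induction m arbitrary: x)
  case 0
  have "cells_at 0 x = (if x \<in> sg_V 0 then {[]} else {})"
    by (auto simp: cells_at_def vertices_def)
  then show ?case by simp
next
  case (Suc m)
  have zero: "card (cells_at m y) = 0" if "i \<in> {0,1,2}" "bary i y < 0" for i y
    using bary_nonneg[of y m i] that cells_at_empty[of y m] by force
  consider (corner) j where "j \<in> {0,1,2}" "x = sg_q j"
    | (inside) "x \<notin> sg_V 0" "x \<in> sg_V (Suc m)" | (outside) "x \<notin> sg_V 0" "x \<notin> sg_V (Suc m)"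
    by auto
  then show ?case
  proof cases
    case corner
    have "unfold_F j x = sg_q j"
      using corner by (simp add: unfold_F_def scaleR_2)
    then have 1: "card (cells_at m (unfold_F j x)) = 1"
      using Suc.IH[of "sg_q j"] corner by auto
    have "card (cells_at m (unfold_F i x)) = (if i = j then 1 else 0)" if "i \<in> {0,1,2}" for i
      using zero[OF that, of "unfold_F i x"] corner that 1 by (simp add: bary_unfold_F bary_q)
    then have "card (cells_at (Suc m) x) = (\<Sum>i\<in>{0,1,2}. if i = j then 1 else 0)"
      unfolding card_cells_at_Suc by (intro sum.cong) auto
    with corner show ?thesis by (auto simp: sum.delta)
  next
    case inside
    then obtain i where i: "i \<in> {0,1,2}" "unfold_F i x \<in> sg_V m"
      using mem_sg_V_Suc by blast
    show ?thesis
    proof (cases "unfold_F i x \<in> sg_V 0")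
      case True
      then obtain j where j: "j \<in> {0,1,2}" "unfold_F i x = sg_q j" by auto
      have x: "x = midpoint (sg_q i) (sg_q j)" using j sg_F_eq_iff sg_F_q by metis
      have "i \<noteq> j" using x inside i by auto
      have "unfold_F j x = sg_q i" using x sg_F_eq_iff sg_F_q midpoint_sym by metis
      then have 1: "card (cells_at m (unfold_F k x)) = 1" if "k \<in> {i, j}" for k
        using Suc.IH[of "sg_q i"] Suc.IH[of "sg_q j"] that i j by auto
      have "bary k x = 0" if "k \<in> {0,1,2}" "k \<noteq> i" "k \<noteq> j" for k
        using bary_unfold_F[OF that(1) i(1), of x] bary_q[OF that(1) j(1)] j that by simp
      then have 0: "card (cells_at m (unfold_F k x)) = 0"
        if "k \<in> {0,1,2}" "k \<noteq> i" "k \<noteq> j" for k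
        using zero[OF that(1), of "unfold_F k x"] that by (simp add: bary_unfold_F)
      have "card (cells_at (Suc m) x) = (\<Sum>k\<in>{0,1,2}. if k \<in> {i, j} then 1 else 0)"
        unfolding card_cells_at_Suc using 0 1 by (intro sum.cong) auto
      also have "\<dots> = 2"
        using i(1) j(1) \<open>i \<noteq> j\<close> by (elim insertE emptyE) simp_all
      finally show ?thesis using inside by simp
    next
      case False
      have 0: "card (cells_at m (unfold_F k x)) = 0" if "k \<in> {0,1,2}" "k \<noteq> i" for k
      proof -
        have "unfold_F k x \<notin> sg_V m"
        proof
          assume "unfold_F k x \<in> sg_V m"
          then have "unfold_F i x = sg_q k"
            using unfold_F_both[OF i(1) that(1) _ i(2)] that(2) by blast
          with False that(1) show False by auto
        qed
        then show ?thesis by (simp add: cells_at_empty)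
      qed
      have "card (cells_at (Suc m) x) = (\<Sum>k\<in>{0,1,2}. if k = i then 2 else 0)"
        unfolding card_cells_at_Suc using 0 Suc.IH[of "unfold_F i x"] i False
        by (intro sum.cong) auto
      then show ?thesis using inside i by (auto simp: sum.delta)
    qed
  next
    case outside
    then show ?thesis using cells_at_empty[of x "Suc m"] by simp
  qed
qed

section \<open>Eigenfunctions in terms of cell sums\<close>

definition cell_sum :: "(plane \<Rightarrow> real) \<Rightarrow> nat list \<Rightarrow> real" where
  "cell_sum u w = (\<Sum>i\<in>{0,1,2}. u (sg_Fw w (sg_q i)))"

lemma inj_on_sg_q: "inj_on sg_q {0,1,2}"
  by (auto simp: inj_on_def sg_q_def)

lemma cell_sum_vertices: "cell_sum u w = (\<Sum>y\<in>vertices w. u y)"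
proof -
  have "inj_on (sg_Fw w) (sg_q ` {0,1,2})" using inj_sg_Fw inj_on_subset by blast
  then have "(\<Sum>y\<in>vertices w. u y) = (\<Sum>x\<in>sg_q ` {0,1,2}. u (sg_Fw w x))"
    unfolding vertices_def by (subst sum.reindex) simp_all
  also have "\<dots> = cell_sum u w"
    unfolding cell_sum_def by (subst sum.reindex[OF inj_on_sg_q]) simp
  finally show ?thesis by simp
qed

text \<open>Each neighbour of \<open>x\<close> belongs to exactly one of the cells at \<open>x\<close>, because a second common cell
  would share two vertices with the first.\<close>

lemma sum_neighbours:
  "(\<Sum>y | sg_adj m x y. g y) = (\<Sum>w\<in>cells_at m x. cell_sum g w - g x)"
proof -
  have "{y. sg_adj m x y} = (\<Union>w\<in>cells_at m x. vertices w - {x})"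
    by (auto simp: sg_adj_def cells_at_def vertices_def)
  also have "(\<Sum>y\<in>\<dots>. g y) = (\<Sum>w\<in>cells_at m x. \<Sum>y\<in>vertices w - {x}. g y)"
  proof (rule sum.UNION_disjoint)
    show "\<forall>w\<in>cells_at m x. \<forall>w'\<in>cells_at m x. w \<noteq> w' \<longrightarrow>
            (vertices w - {x}) \<inter> (vertices w' - {x}) = {}"
      using vertices_inter_subsingleton unfolding cells_at_def by blast
  qed (auto simp: vertices_def)
  also have "\<dots> = (\<Sum>w\<in>cells_at m x. cell_sum g w - g x)"
    by (intro sum.cong refl) (auto simp: cells_at_def cell_sum_vertices vertices_def sum_diff1)
  finally show ?thesis .
qed

text \<open>At a vertex with two cells the graph Laplacian is \<open>6 u x\<close> minus the two cell sums; at a corner the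
  weights 4 and 2 of the Neumann condition give the same relation with one cell counted twice.
  Outside \<open>V\<^sub>m\<close> both sides vanish, so this is an identity of functions on the plane.\<close>

lemma neumann_eigenfunction_cell_sums:
  assumes "neumann_eigenfunction m lam u"
  shows "(6 - lam) * u x = 2 / real (card (cells_at m x)) * (\<Sum>w\<in>cells_at m x. cell_sum u w)"
proof -
  note eig = assms[unfolded neumann_eigenfunction_def]
  consider (corner) i where "i \<in> {0,1,2}" "x = sg_q i"
    | (inside) "x \<in> sg_V m - sg_V 0" | (outside) "x \<notin> sg_V m" by auto
  then show ?thesis
  proof cases
    case corner
    then have card: "card (cells_at m x) = 1" using card_cells_at[of m x] by auto
    have "(4 - lam) * u x = 2 * (\<Sum>y | sg_adj m x y. u y)"
      using eig corner by blast
    also have "\<dots> = 2 * ((\<Sum>w\<in>cells_at m x. cell_sum u w) - u x)"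
      by (simp add: sum_neighbours sum_subtractf card)
    finally show ?thesis by (simp add: card algebra_simps)
  next
    case inside
    then have card: "card (cells_at m x) = 2" using card_cells_at[of m x] by auto
    have "lam * u x = (\<Sum>y | sg_adj m x y. u x - u y)" using eig inside by simp
    also have "\<dots> = (\<Sum>w\<in>cells_at m x. 3 * u x - cell_sum u w)"
      by (simp add: sum_neighbours cell_sum_def algebra_simps)
    also have "\<dots> = 6 * u x - (\<Sum>w\<in>cells_at m x. cell_sum u w)"
      by (simp add: sum_subtractf card)
    finally show ?thesis by (simp add: card algebra_simps)
  next
    case outside
    then have "u x = 0" using eig by blast
    with outside show ?thesis by (simp add: cells_at_empty)
  qed
qed

lemma sum_fun_apply: "(\<Sum>a\<in>A. f a) x = (\<Sum>a\<in>A. f a x)"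
  for f :: "'a \<Rightarrow> 'b \<Rightarrow> 'c::comm_monoid_add"
  by (induction A rule: infinite_finite_induct) simp_all

lemma cell_sum_sum: "cell_sum (\<Sum>b\<in>T. c b *\<^sub>R f b) w = (\<Sum>b\<in>T. c b * cell_sum (f b) w)"
  unfolding cell_sum_def sum_fun_apply sum_distrib_left scaleR_fun_apply real_scaleR_def
  by (rule sum.swap)

text \<open>The right-hand side of \<open>neumann_eigenfunction_cell_sums\<close> is linear in \<open>u\<close> and vanishes when all cell sums do,
  so the combination with coefficients \<open>c b * (6 - lam b)\<close> is zero.\<close>

lemma coefficients_zero_if_cell_sums_zero:
  assumes indep: "independent B" and T: "finite T" "T \<subseteq> B"
    and eig: "\<And>b. b \<in> T \<Longrightarrow> lam b \<noteq> 6 \<and> neumann_eigenfunction m (lam b) b"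
    and zero: "\<And>w. w \<in> sg_words m \<Longrightarrow> (\<Sum>b\<in>T. c b * cell_sum b w) = 0"
    and "b \<in> T"
  shows "c b = 0"
proof -
  have "(\<Sum>b\<in>T. (c b * (6 - lam b)) *\<^sub>R b) = 0"
  proof
    fix x
    let ?k = "2 / real (card (cells_at m x))"
    have "(\<Sum>b\<in>T. (c b * (6 - lam b)) *\<^sub>R b) x = (\<Sum>b\<in>T. c b * ((6 - lam b) * b x))"
      by (simp add: sum_fun_apply mult.assoc)
    also have "\<dots> = (\<Sum>b\<in>T. \<Sum>w\<in>cells_at m x. ?k * (c b * cell_sum b w))"
    proof (intro sum.cong refl)
      fix b assume "b \<in> T"
      then have "(6 - lam b) * b x = ?k * (\<Sum>w\<in>cells_at m x. cell_sum b w)"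
        using eig neumann_eigenfunction_cell_sums by blast
      then show "c b * ((6 - lam b) * b x) = (\<Sum>w\<in>cells_at m x. ?k * (c b * cell_sum b w))"
        by (simp add: sum_distrib_left sum_divide_distrib mult_ac)
    qed
    also have "\<dots> = ?k * (\<Sum>w\<in>cells_at m x. \<Sum>b\<in>T. c b * cell_sum b w)"
      by (subst sum.swap) (simp add: sum_distrib_left)
    also have "\<dots> = 0"
      using zero by (simp add: cells_at_def)
    finally show "(\<Sum>b\<in>T. (c b * (6 - lam b)) *\<^sub>R b) x = 0 x" by simp
  qed
  then have "c b * (6 - lam b) = 0"
    by (rule independentD[OF indep T _ \<open>b \<in> T\<close>])
  with eig[OF \<open>b \<in> T\<close>] show ?thesis by simp
qed

section \<open>Cell sums under spectral decimation\<close>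

text \<open>The three subcells see each corner of the cell once and each midpoint twice, and the continuation
  formula gives \<open>2 / (2 - lam')\<close> times the cell sum for the sum over the midpoints.\<close>

lemma sg_continuation_cell_sums:
  assumes cont: "sg_continuation n lam u lam' u'" and w: "w \<in> sg_words n"
  shows "(\<Sum>i\<in>{0,1,2}. cell_sum u' (i # w)) = (6 - lam') / (2 - lam') * cell_sum u w"
proof -
  have ne: "2 - lam' \<noteq> 0" "5 - lam' \<noteq> 0"
    using cont by (auto simp: sg_continuation_def)
  define a where "a i = u (sg_Fw w (sg_q i))" for i
  define p where "p i j = u' (sg_Fw w (midpoint (sg_q i) (sg_q j)))" for i j
  have p: "p i j = ((4 - lam') * (a i + a j) + 2 * a k) / ((2 - lam') * (5 - lam'))"
    if "{i, j, k} = {0,1,2}" for i j k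
    using cont w that by (auto simp: sg_continuation_def Let_def p_def a_def sg_Fw_midpoint)
  have pii: "p i i = a i" if "i \<in> {0,1,2}" for i
  proof -
    have "sg_Fw w (sg_q i) \<in> sg_V n"
      using w that unfolding sg_V_eq_Union_vertices vertices_def by blast
    then show ?thesis using cont by (simp add: sg_continuation_def p_def a_def)
  qed
  have p01: "p 0 1 = ((4 - lam') * (a 0 + a 1) + 2 * a 2) / ((2 - lam') * (5 - lam'))"
    by (rule p) auto
  have p02: "p 0 2 = ((4 - lam') * (a 0 + a 2) + 2 * a 1) / ((2 - lam') * (5 - lam'))"
    by (rule p) auto
  have p12: "p 1 2 = ((4 - lam') * (a 1 + a 2) + 2 * a 0) / ((2 - lam') * (5 - lam'))"
    by (rule p) auto
  have "p 0 1 + p 0 2 + p 1 2 =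
      ((10 - 2 * lam') * (a 0 + a 1 + a 2)) / ((2 - lam') * (5 - lam'))"
    unfolding p01 p02 p12 by (simp add: add_divide_distrib[symmetric] algebra_simps)
  also have "\<dots> = (2 * (a 0 + a 1 + a 2)) / (2 - lam')"
    using ne by (simp add: frac_eq_eq) (simp add: algebra_simps)
  finally have mid: "p 0 1 + p 0 2 + p 1 2 = (2 * (a 0 + a 1 + a 2)) / (2 - lam')" .
  have sym: "p i j = p j i" for i j by (simp add: p_def midpoint_sym)
  have "(\<Sum>i\<in>{0,1,2}. cell_sum u' (i # w)) = (\<Sum>i\<in>{0,1,2}. \<Sum>j\<in>{0,1,2}. p i j)"
    by (simp add: cell_sum_def sg_F_q p_def)
  also have "\<dots> = (a 0 + a 1 + a 2) + 2 * (p 0 1 + p 0 2 + p 1 2)"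
    using sym[of 0 1] sym[of 0 2] sym[of 1 2] pii[of 0] pii[of 1] pii[of 2] by simp
  also have "\<dots> = (6 - lam') / (2 - lam') * (a 0 + a 1 + a 2)"
    unfolding mid using ne by (simp add: field_simps)
  also have "a 0 + a 1 + a 2 = cell_sum u w" by (simp add: cell_sum_def a_def)
  finally show ?thesis .
qed

text \<open>The other factor \<open>5 - l'\<close> is \<open>(5 + sqrt (25 - 4 * l)) / 2\<close>, hence at least \<open>5/2\<close>. The
  second hypothesis matters when \<open>25 - 4 * l\<close> might be negative, where \<^const>\<open>sqrt\<close> takes a
  negative value: it forces \<open>25 - 4 * l\<close> to be a square.\<close>

lemma decimation_root_contracts:
  assumes "l' = (5 - sqrt (25 - 4 * l)) / 2" "l = l' * (5 - l')"
  shows "\<bar>l'\<bar> \<le> 2/5 * \<bar>l\<bar>"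
proof -
  define s where "s = sqrt (25 - 4 * l)"
  have l': "l' = (5 - s) / 2" using assms(1) by (simp add: s_def)
  then have "5 - l' = (5 + s) / 2" by (simp add: field_simps)
  with assms(2) have l: "l = l' * ((5 + s) / 2)" by metis
  then have "25 - 4 * l = s\<^sup>2" using l' by (simp add: field_simps power2_eq_square)
  then have "25 - 4 * l \<ge> 0" using zero_le_power2[of s] by linarith
  then have "s \<ge> 0" unfolding s_def by simp
  then have "\<bar>l'\<bar> * (5/2) \<le> \<bar>l'\<bar> * ((5 + s) / 2)" by (intro mult_left_mono) auto
  also have "\<dots> = \<bar>l\<bar>" using \<open>s \<ge> 0\<close> by (subst l) (simp add: abs_mult)
  finally show ?thesis by simp
qed

text \<open>Each factor is \<open>1 + a\<close> with \<open>a = 2 \<lambda> / (3 (2 - \<lambda>))\<close>. The geometric decay of \<open>\<lambda>\<close> makes the terms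
  \<open>a\<close> absolutely summable, so the product converges; its limit is nonzero since no factor vanishes.\<close>

lemma decimation_product_convergent:
  fixes l :: "nat \<Rightarrow> real"
  assumes contr: "\<And>n. \<bar>l (Suc n)\<bar> \<le> 2/5 * \<bar>l n\<bar>" and ne: "\<And>n. l n \<notin> {2, 6}"
  obtains \<gamma> where "\<gamma> \<noteq> 0" "(\<lambda>k. \<Prod>j<k. (6 - l j) / (3 * (2 - l j))) \<longlonglongrightarrow> \<gamma>"
proof -
  define a where "a j = 2 * l j / (3 * (2 - l j))" for j
  have a: "(6 - l j) / (3 * (2 - l j)) = 1 + a j" for j
    using ne[of j] by (simp add: a_def field_simps)
  have "\<bar>l n\<bar> \<le> \<bar>l 0\<bar> * (2/5) ^ n" for n
  proof (induction n)
    case (Suc n)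
    have "\<bar>l (Suc n)\<bar> \<le> 2/5 * \<bar>l n\<bar>" by (rule contr)
    also have "\<dots> \<le> 2/5 * (\<bar>l 0\<bar> * (2/5) ^ n)" using Suc by (intro mult_left_mono) auto
    finally show ?case by (simp add: mult_ac)
  qed simp
  moreover have "summable (\<lambda>n. \<bar>l 0\<bar> * (2/5 :: real) ^ n)"
    by (intro summable_mult summable_geometric) simp
  ultimately have suml: "summable (\<lambda>n. \<bar>l n\<bar>)"
    using summable_comparison_test'[of "\<lambda>n. \<bar>l 0\<bar> * (2/5) ^ n" 0 "\<lambda>n. \<bar>l n\<bar>"] by simp
  then have "(\<lambda>n. \<bar>l n\<bar>) \<longlonglongrightarrow> 0" by (rule summable_LIMSEQ_zero)
  then have "\<forall>\<^sub>F n in sequentially. \<bar>l n\<bar> < 1" by (rule order_tendstoD) simp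
  then have "\<forall>\<^sub>F n in sequentially. norm (norm (a n)) \<le> \<bar>l n\<bar>"
  proof eventually_elim
    case (elim n)
    then have "2 * \<bar>l n\<bar> / (3 * (2 - l n)) \<le> 2 * \<bar>l n\<bar> / 2"
      by (intro divide_left_mono) auto
    moreover have "norm (a n) = 2 * \<bar>l n\<bar> / (3 * (2 - l n))"
      using elim by (simp add: a_def abs_mult)
    ultimately show ?case by (simp only: real_norm_def abs_idempotent)
  qed
  then have "summable (\<lambda>n. norm (a n))" by (rule summable_comparison_test_ev[OF _ suml])
  then have "abs_convergent_prod (\<lambda>n. 1 + a n)"
    by (simp add: abs_convergent_prod_conv_summable)
  then have conv: "convergent_prod (\<lambda>n. 1 + a n)"
    by (rule abs_convergent_prod_imp_convergent_prod)
  have nz: "1 + a n \<noteq> 0" for n using ne[of n] by (simp flip: a)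
  have "(\<lambda>n. \<Prod>j\<le>n. 1 + a j) \<longlonglongrightarrow> prodinf (\<lambda>n. 1 + a n)"
    by (rule convergent_prod_LIMSEQ[OF conv])
  then have "(\<lambda>n. \<Prod>j<n. 1 + a j) \<longlonglongrightarrow> prodinf (\<lambda>n. 1 + a n)"
    by (subst filterlim_sequentially_Suc[symmetric]) (simp add: lessThan_Suc_atMost)
  moreover have "prodinf (\<lambda>n. 1 + a n) \<noteq> 0"
    using prodinf_nonzero[OF conv nz] .
  ultimately show ?thesis using that[of "prodinf (\<lambda>n. 1 + a n)"] unfolding a by blast
qed

lemma decimation_extension_agrees:
  assumes "decimation_extension m lam b f" "x \<in> sg_V m"
  shows "f x = b x"
  using assms unfolding decimation_extension_def by auto

lemma cell_sum_cong:
  assumes "w \<in> sg_words m" "\<And>x. x \<in> sg_V m \<Longrightarrow> u x = v x"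
  shows "cell_sum u w = cell_sum v w"
  unfolding cell_sum_def using assms
  by (intro sum.cong refl assms(2)) (auto simp: sg_V_eq_Union_vertices vertices_def)

text \<open>The number \<open>\<gamma>\<close> is chosen before the cell \<open>w\<close>: the refinement factors depend on the eigenvalues
  alone, which is what lets integrals be traded for cell sums in a whole linear combination.\<close>

lemma decimation_extension_cell_sums:
  assumes ext: "decimation_extension m lam b f"
  obtains \<gamma> where "\<gamma> \<noteq> 0"
    "\<And>w. w \<in> sg_words m \<Longrightarrow>
       (\<lambda>k. (\<Sum>v\<in>sg_words k. cell_sum f (v @ w)) / 3 ^ k) \<longlonglongrightarrow> \<gamma> * cell_sum b w"
proof -
  obtain l us where lus: "l m = lam" "us m = b"
    "\<And>n. n \<ge> m \<Longrightarrow> l (Suc n) = (5 - sqrt (25 - 4 * l n)) / 2"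
    "\<And>n. n \<ge> m \<Longrightarrow> sg_continuation n (l n) (us n) (l (Suc n)) (us (Suc n))"
    "\<And>n x. n \<ge> m \<Longrightarrow> x \<in> sg_V n \<Longrightarrow> f x = us n x"
    using ext unfolding decimation_extension_def by blast
  define r where "r j = (6 - l (Suc (m + j))) / (3 * (2 - l (Suc (m + j))))" for j
  have r: "3 * r j = (6 - l (Suc (m + j))) / (2 - l (Suc (m + j)))" for j
    unfolding r_def times_divide_eq_right by (rule mult_divide_mult_cancel_left) simp
  have lprops: "l n = l (Suc n) * (5 - l (Suc n))" "l (Suc n) \<notin> {2, 6}" if "n \<ge> m" for n
    using lus(4)[OF that] unfolding sg_continuation_def by auto
  have contr: "\<bar>l (Suc (m + Suc n))\<bar> \<le> 2/5 * \<bar>l (Suc (m + n))\<bar>" for n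
  proof -
    have n: "m \<le> Suc (m + n)" by simp
    show ?thesis using decimation_root_contracts[OF lus(3)[OF n] lprops(1)[OF n]] by simp
  qed
  obtain \<gamma> where \<gamma>: "\<gamma> \<noteq> 0" "(\<lambda>k. \<Prod>j<k. r j) \<longlonglongrightarrow> \<gamma>"
    unfolding r_def
    by (rule decimation_product_convergent[of "\<lambda>n. l (Suc (m + n))", OF contr lprops(2)]) simp_all
  have children: "(\<Sum>i\<in>{0,1,2}. cell_sum f (i # w)) = 3 * r k * cell_sum f w"
    if w: "w \<in> sg_words (m + k)" for w k
  proof -
    have iw: "i # w \<in> sg_words (Suc (m + k))" if "i \<in> {0,1,2}" for i
      using w that by (auto simp: sg_words_def)
    have "(\<Sum>i\<in>{0,1,2}. cell_sum f (i # w)) = (\<Sum>i\<in>{0,1,2}. cell_sum (us (Suc (m + k))) (i # w))"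
      by (intro sum.cong refl cell_sum_cong[OF iw] lus(5)) auto
    also have "\<dots> = 3 * r k * cell_sum (us (m + k)) w"
      unfolding r by (rule sg_continuation_cell_sums[OF lus(4) w]) simp
    also have "cell_sum (us (m + k)) w = cell_sum f w"
      by (intro cell_sum_cong[OF w] lus(5)[symmetric]) auto
    finally show ?thesis .
  qed
  have "(\<Sum>v\<in>sg_words k. cell_sum f (v @ w)) / 3 ^ k = (\<Prod>j<k. r j) * cell_sum b w"
    if w: "w \<in> sg_words m" for w k
  proof (induction k)
    case 0
    show ?case using cell_sum_cong[OF w lus(5)[of m]] lus(2) by simp
  next
    case (Suc k)
    have inj: "inj_on (\<lambda>(i, v). i # v) ({0,1,2} \<times> sg_words k)" by (auto simp: inj_on_def)
    have "(\<Sum>v\<in>sg_words (Suc k). cell_sum f (v @ w)) =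
        (\<Sum>i\<in>{0,1,2}. \<Sum>v\<in>sg_words k. cell_sum f (i # (v @ w)))"
      unfolding sg_words_Suc sum.reindex[OF inj]
      by (simp only: sum.cartesian_product) (intro sum.cong, auto)
    also have "\<dots> = (\<Sum>v\<in>sg_words k. 3 * r k * cell_sum f (v @ w))"
      by (subst sum.swap) (intro sum.cong refl children sg_words_append w)
    finally show ?case using Suc by (simp add: field_simps flip: sum_distrib_left)
  qed
  then show ?thesis using that[OF \<gamma>(1)] \<gamma>(2) by (simp add: tendsto_mult_right)
qed

section \<open>Integrals as limits of cell averages\<close>

lemma sg_Fw_in_SG: "set w \<subseteq> {0,1,2} \<Longrightarrow> x \<in> SG \<Longrightarrow> sg_Fw w x \<in> SG"
proof (induction w arbitrary: x)
  case (Cons i w)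
  then have "sg_F i x \<in> SG" by (subst SG_props(3)) auto
  with Cons show ?case by simp
qed simp

text \<open>Applying the map \<open>F\<^sub>i\<close>, which fixes \<open>q\<^sub>i\<close>, to a point of the gasket nearest to \<open>q\<^sub>i\<close> halves the
  distance, which must therefore be zero.\<close>

lemma sg_q_in_SG:
  assumes "i \<in> {0,1,2}"
  shows "sg_q i \<in> SG"
proof -
  have closed: "closed SG" using SG_props(1) compact_imp_closed by blast
  obtain c where c: "c \<in> SG" "infdist (sg_q i) SG = dist (sg_q i) c"
    using infdist_attains_inf[OF closed SG_props(2)] by blast
  have "sg_F i c \<in> SG" using sg_Fw_in_SG[of "[i]" c] assms c by simp
  moreover have "sg_F i (sg_q i) = sg_q i" by (simp add: sg_F_def)
  ultimately have "infdist (sg_q i) SG \<le> dist (sg_q i) c / 2"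
    by (metis dist_sg_F infdist_le)
  then have "infdist (sg_q i) SG = 0" using c infdist_nonneg[of "sg_q i" SG] by simp
  then show ?thesis using in_closed_iff_infdist_zero[OF closed SG_props(2)] by blast
qed

lemma sg_cell_subset: "w \<in> sg_words n \<Longrightarrow> sg_cell w \<subseteq> SG"
  using sg_Fw_in_SG by (auto simp: sg_cell_def sg_words_def)

lemma compact_sg_cell: "compact (sg_cell w)"
proof -
  have "1-lipschitz_on SG (sg_Fw w)"
    by (rule lipschitz_onI) (simp_all add: dist_sg_Fw divide_le_eq mult_le_cancel_left1)
  then show ?thesis
    unfolding sg_cell_def
    using compact_continuous_image SG_props(1) lipschitz_on_continuous_on by blast
qed

lemma SG_eq_Union_cells: "SG = (\<Union>v\<in>sg_words k. sg_cell v)"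
proof (induction k)
  case (Suc k)
  have "(\<Union>v\<in>sg_words (Suc k). sg_cell v) = (\<Union>v\<in>sg_words k. sg_Fw v ` (\<Union>i\<in>{0,1,2}. sg_F i ` SG))"
    unfolding sg_words_Suc sg_cell_def by (simp add: image_UN image_image UN_UN_flatten Sigma_def) blast
  also have "\<dots> = SG" unfolding SG_props(3)[symmetric] using Suc by (simp add: sg_cell_def)
  finally show ?case by simp
qed (simp add: sg_cell_def)

text \<open>The first letter of a word is applied first, so the subcells of the cell of \<open>w\<close> belong to the
  words with extra letters in front.\<close>

lemma sg_cell_eq_Union: "sg_cell w = (\<Union>v\<in>sg_words k. sg_cell (v @ w))"
proof -
  have "sg_cell w = sg_Fw w ` (\<Union>v\<in>sg_words k. sg_cell v)"
    using SG_eq_Union_cells[of k] by (simp add: sg_cell_def)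
  also have "\<dots> = (\<Union>v\<in>sg_words k. sg_cell (v @ w))"
    by (simp add: sg_cell_def image_UN image_image)
  finally show ?thesis .
qed

lemma sg_q_in_cell: "i \<in> {0,1,2} \<Longrightarrow> sg_Fw w (sg_q i) \<in> sg_cell w"
  using sg_q_in_SG by (simp add: sg_cell_def)

context
  fixes \<mu> :: "plane measure"
  assumes \<mu>: "sg_measure \<mu>"
begin

interpretation prob_space \<mu>
  using \<mu> by (simp add: sg_measure_def)

lemma sets_sg: "sets \<mu> = sets (restrict_space borel SG)"
  using \<mu> by (simp add: sg_measure_def)

lemma space_sg: "space \<mu> = SG"
  using sets_eq_imp_space_eq[OF sets_sg] by (simp add: space_restrict_space)

lemma sg_cell_sets: "w \<in> sg_words n \<Longrightarrow> sg_cell w \<in> sets \<mu>"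
  unfolding sets_sg sets_restrict_space
  using compact_sg_cell[of w] sg_cell_subset[of w n]
  by (intro image_eqI[of _ _ "sg_cell w"]) (auto intro: borel_compact)

lemma measure_sg_cell: "w \<in> sg_words n \<Longrightarrow> measure \<mu> (sg_cell w) = 1 / 3 ^ n"
  using \<mu> by (simp add: sg_measure_def)

lemma integrable_continuous_SG:
  assumes "continuous_on SG f"
  shows "integrable \<mu> (f :: plane \<Rightarrow> real)"
proof -
  have "f \<in> borel_measurable \<mu>"
    using borel_measurable_continuous_on_restrict[OF assms] measurable_cong_sets[OF sets_sg refl]
    by blast
  moreover obtain K where "\<And>x. x \<in> SG \<Longrightarrow> norm (f x) \<le> K"
    using compact_imp_bounded[OF compact_continuous_image[OF assms SG_props(1)]]
    unfolding bounded_iff by blast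
  ultimately show ?thesis
    by (intro integrable_const_bound[where B = K]) (auto simp: space_sg)
qed

lemma set_integrable_cell:
  assumes "continuous_on SG f" "w \<in> sg_words n"
  shows "set_integrable \<mu> (sg_cell w) (f :: plane \<Rightarrow> real)"
  unfolding set_integrable_def
  by (intro integrable_mult_indicator sg_cell_sets[OF assms(2)] integrable_continuous_SG assms)

text \<open>Overlaps of subcells are null sets: the sum of the indicators minus the indicator of the union is
  nonnegative, and its integral vanishes because the measures of the subcells add up to that of the
  cell.\<close>

lemma AE_indicator_cell:
  assumes w: "w \<in> sg_words m"
  shows "AE x in \<mu>. (\<Sum>v\<in>sg_words k. indicator (sg_cell (v @ w)) x) = (indicator (sg_cell w) x :: real)"
proof -
  define g :: "plane \<Rightarrow> real" where
    "g x = (\<Sum>v\<in>sg_words k. indicator (sg_cell (v @ w)) x) - indicator (sg_cell w) x" for x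
  have sub: "sg_cell (v @ w) \<in> sets \<mu>" "measure \<mu> (sg_cell (v @ w)) = 1 / 3 ^ (m + k)"
    if "v \<in> sg_words k" for v
    using sg_words_append[OF that w] sg_cell_sets measure_sg_cell by blast+
  have nonneg: "g x \<ge> 0" for x
  proof (cases "x \<in> sg_cell w")
    case True
    then obtain v where v: "v \<in> sg_words k" "x \<in> sg_cell (v @ w)"
      using sg_cell_eq_Union by blast
    have "indicator (sg_cell (v @ w)) x \<le> (\<Sum>v\<in>sg_words k. indicator (sg_cell (v @ w)) x :: real)"
      using v by (intro member_le_sum) auto
    then show ?thesis using True v by (simp add: g_def)
  qed (simp add: g_def sum_nonneg)
  have int: "integrable \<mu> (indicator (sg_cell (v @ w)) :: plane \<Rightarrow> real)" if "v \<in> sg_words k" for v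
    using sub[OF that] by (simp add: emeasure_eq_measure)
  have intw: "integrable \<mu> (indicator (sg_cell w) :: plane \<Rightarrow> real)"
    using sg_cell_sets[OF w] by (simp add: emeasure_eq_measure)
  have "integrable \<mu> g"
    unfolding g_def by (intro Bochner_Integration.integrable_diff Bochner_Integration.integrable_sum int intw)
  moreover have "integral\<^sup>L \<mu> g = (\<Sum>v\<in>sg_words k. 1 / 3 ^ (m + k)) - 1 / 3 ^ m"
    unfolding g_def using int intw sub sg_cell_sets[OF w] measure_sg_cell[OF w]
    by (simp add: Bochner_Integration.integral_diff Bochner_Integration.integral_sum)
  then have "integral\<^sup>L \<mu> g = 0" by (simp add: card_sg_words power_add)
  ultimately have "AE x in \<mu>. g x = 0"
    using nonneg integral_nonneg_eq_0_iff_AE[of \<mu> g] by blast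
  then show ?thesis by (simp add: g_def)
qed

lemma set_integral_cell_subdivide:
  assumes w: "w \<in> sg_words m" and f: "continuous_on SG (f :: plane \<Rightarrow> real)"
  shows "(LINT x:sg_cell w|\<mu>. f x) = (\<Sum>v\<in>sg_words k. LINT x:sg_cell (v @ w)|\<mu>. f x)"
proof -
  have int: "integrable \<mu> (\<lambda>x. indicator (sg_cell (v @ w)) x *\<^sub>R f x)" if "v \<in> sg_words k" for v
    using set_integrable_cell[OF f sg_words_append[OF that w]] by (simp add: set_integrable_def)
  have meas: "(\<lambda>x. indicator (sg_cell w) x *\<^sub>R f x) \<in> borel_measurable \<mu>"
    using set_integrable_cell[OF f w] by (simp add: set_integrable_def)
  have "(LINT x:sg_cell w|\<mu>. f x) = (LINT x|\<mu>. (\<Sum>v\<in>sg_words k. indicator (sg_cell (v @ w)) x *\<^sub>R f x))"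
    unfolding set_lebesgue_integral_def
  proof (rule integral_cong_AE[OF meas])
    show "(\<lambda>x. \<Sum>v\<in>sg_words k. indicator (sg_cell (v @ w)) x *\<^sub>R f x) \<in> borel_measurable \<mu>"
      using int by (intro borel_measurable_sum) auto
    show "AE x in \<mu>. indicator (sg_cell w) x *\<^sub>R f x =
        (\<Sum>v\<in>sg_words k. indicator (sg_cell (v @ w)) x *\<^sub>R f x)"
      using AE_indicator_cell[OF w, of k]
      by eventually_elim (simp add: sum_distrib_right[symmetric])
  qed
  also have "\<dots> = (\<Sum>v\<in>sg_words k. LINT x:sg_cell (v @ w)|\<mu>. f x)"
    unfolding set_lebesgue_integral_def using int by (rule Bochner_Integration.integral_sum)
  finally show ?thesis .
qed

lemma cell_integral_approx:
  assumes w: "w \<in> sg_words n" and f: "continuous_on SG (f :: plane \<Rightarrow> real)"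
    and osc: "\<And>x y. x \<in> sg_cell w \<Longrightarrow> y \<in> sg_cell w \<Longrightarrow> \<bar>f x - f y\<bar> \<le> e"
  shows "\<bar>3 ^ n * (LINT x:sg_cell w|\<mu>. f x) - cell_sum f w / 3\<bar> \<le> e"
proof -
  define A where "A = cell_sum f w / 3"
  have near: "\<bar>f x - A\<bar> \<le> e" if "x \<in> sg_cell w" for x
    using osc[OF that sg_q_in_cell[of 0]] osc[OF that sg_q_in_cell[of 1]]
      osc[OF that sg_q_in_cell[of 2]]
    by (simp add: A_def cell_sum_def abs_le_iff field_simps)
  have const: "(LINT x:sg_cell w|\<mu>. c) = c / 3 ^ n" for c :: real
    using measure_sg_cell[OF w] sg_cell_sets[OF w] by (simp add: set_lebesgue_integral_def)
  have cint: "set_integrable \<mu> (sg_cell w) (\<lambda>x. c)" for c :: real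
    by (rule set_integrable_cell[OF _ w]) simp
  note fint = set_integrable_cell[OF f w]
  have "(LINT x:sg_cell w|\<mu>. f x) \<le> (LINT x:sg_cell w|\<mu>. (A + e))"
    using near by (intro set_integral_mono fint cint) (auto simp: abs_le_iff algebra_simps)
  moreover have "(LINT x:sg_cell w|\<mu>. (A - e)) \<le> (LINT x:sg_cell w|\<mu>. f x)"
    using near by (intro set_integral_mono fint cint) (auto simp: abs_le_iff algebra_simps)
  ultimately have "A - e \<le> 3 ^ n * (LINT x:sg_cell w|\<mu>. f x)"
    "3 ^ n * (LINT x:sg_cell w|\<mu>. f x) \<le> A + e"
    by (simp_all add: const field_simps)
  then show ?thesis by (simp add: A_def abs_le_iff)
qed

text \<open>By uniform continuity a function oscillates little on all cells of a high level, so that replacing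
  it by its corner average on each of them changes the integral by little. The factor 3 on the right
  appears because a cell sum is three times the corner average.\<close>

lemma cell_averages_tendsto_integral:
  assumes w: "w \<in> sg_words m" and f: "continuous_on SG (f :: plane \<Rightarrow> real)"
  shows "(\<lambda>k. (\<Sum>v\<in>sg_words k. cell_sum f (v @ w)) / 3 ^ k)
           \<longlonglongrightarrow> 3 * (3 ^ m * (LINT x:sg_cell w|\<mu>. f x))"
proof (rule LIMSEQ_I)
  fix e :: real assume "e > 0"
  then have e6: "e / 6 > 0" by simp
  obtain d where d: "d > 0" "\<And>x y. x \<in> SG \<Longrightarrow> y \<in> SG \<Longrightarrow> dist y x < d \<Longrightarrow> dist (f y) (f x) < e / 6"
    by (rule uniformly_continuous_onE[OF compact_uniformly_continuous[OF f SG_props(1)] e6])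
      (rule that)
  obtain D where D: "\<And>x y. x \<in> SG \<Longrightarrow> y \<in> SG \<Longrightarrow> dist x y \<le> D"
    using compact_imp_bounded[OF SG_props(1)] unfolding bounded_two_points by blast
  have "(\<lambda>k. D * (1/2) ^ k) \<longlonglongrightarrow> D * 0"
    by (intro tendsto_intros) simp
  then have "\<forall>\<^sub>F k in sequentially. D * (1/2) ^ k < d"
    using d(1) by (intro order_tendstoD(2)[where y = "D * 0"]) auto
  then obtain N where N: "\<And>k. k \<ge> N \<Longrightarrow> D * (1/2) ^ k < d"
    unfolding eventually_sequentially by blast
  have "norm ((\<Sum>v\<in>sg_words k. cell_sum f (v @ w)) / 3 ^ k
            - 3 * (3 ^ m * (LINT x:sg_cell w|\<mu>. f x))) < e" if "k \<ge> N" for k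
  proof -
    let ?I = "\<lambda>v. 3 ^ (m + k) * (LINT x:sg_cell (v @ w)|\<mu>. f x)"
    have osc: "\<bar>f x - f y\<bar> \<le> e / 6"
      if v: "v \<in> sg_words k" and xy: "x \<in> sg_cell (v @ w)" "y \<in> sg_cell (v @ w)" for v x y
    proof -
      note vw = sg_words_append[OF v w]
      obtain a b where ab: "a \<in> SG" "b \<in> SG" "x = sg_Fw (v @ w) a" "y = sg_Fw (v @ w) b"
        using xy unfolding sg_cell_def by blast
      have "dist x y = dist a b / 2 ^ (m + k)"
        using ab(3,4) vw dist_sg_Fw[of "v @ w" a b] by (simp add: sg_words_def)
      also have "\<dots> \<le> D / 2 ^ (m + k)" using D[OF ab(1,2)] by (intro divide_right_mono) auto
      also have "\<dots> = D * (1/2) ^ (m + k)" by (simp add: power_divide)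
      also have "\<dots> < d" using N[of "m + k"] that \<open>k \<ge> N\<close> by simp
      finally have "dist (f x) (f y) < e / 6"
        using d(2) xy sg_cell_subset[OF vw] by blast
      then show ?thesis by (simp add: dist_real_def)
    qed
    define I where "I = 3 ^ m * (LINT x:sg_cell w|\<mu>. f x)"
    define S where "S = (\<Sum>v\<in>sg_words k. cell_sum f (v @ w))"
    have "\<bar>(\<Sum>v\<in>sg_words k. ?I v - cell_sum f (v @ w) / 3)\<bar> \<le> (\<Sum>v\<in>sg_words k. e / 6)"
      using cell_integral_approx[OF sg_words_append[OF _ w] f osc]
      by (intro order_trans[OF sum_abs] sum_mono) auto
    moreover have "(\<Sum>v\<in>sg_words k. ?I v) = 3 ^ k * I"
      by (simp add: I_def set_integral_cell_subdivide[OF w f, of k] sum_distrib_left power_add mult_ac)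
    ultimately have approx: "\<bar>3 ^ k * I - S / 3\<bar> \<le> 3 ^ k * (e / 6)"
      by (simp add: sum_subtractf card_sg_words sum_divide_distrib S_def)
    have "S / 3 ^ k - 3 * I = - (3 / 3 ^ k) * (3 ^ k * I - S / 3)"
      by (simp add: field_simps)
    then have "\<bar>S / 3 ^ k - 3 * I\<bar> = 3 / 3 ^ k * \<bar>3 ^ k * I - S / 3\<bar>"
      by (simp only: abs_mult) simp
    also have "\<dots> \<le> 3 / 3 ^ k * (3 ^ k * (e / 6))"
      using approx by (intro mult_left_mono) auto
    also have "\<dots> < e" using \<open>e > 0\<close> by simp
    finally show ?thesis by (simp add: I_def S_def)
  qed
  then show "\<exists>N. \<forall>k\<ge>N. norm ((\<Sum>v\<in>sg_words k. cell_sum f (v @ w)) / 3 ^ k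
            - 3 * (3 ^ m * (LINT x:sg_cell w|\<mu>. f x))) < e" by blast
qed

end

section \<open>Unique determination\<close>

lemma boundary_average_eq_iff:
  "boundary_average m u = boundary_average m v \<longleftrightarrow>
     (\<forall>w\<in>sg_words m. cell_sum (u - v) w = 0)"
  by (auto simp: boundary_average_def cell_sum_def restrict_def fun_eq_iff algebra_simps)

lemma integral_average_eqD:
  assumes "sg_measure \<mu>" "continuous_on SG u" "continuous_on SG v"
    and "integral_average \<mu> m u = integral_average \<mu> m v" and w: "w \<in> sg_words m"
  shows "(LINT x:sg_cell w|\<mu>. (u - v) x) = 0"
proof -
  have "(LINT x:sg_cell w|\<mu>. u x) = (LINT x:sg_cell w|\<mu>. v x)"
    using fun_cong[OF assms(4), of w] w by (simp add: integral_average_def)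
  then show ?thesis
    using set_integral_diff(2)[OF set_integrable_cell[OF assms(1,2) w] set_integrable_cell[OF assms(1,3) w]]
    by simp
qed

lemma continuous_on_span:
  assumes "\<And>f. f \<in> E \<Longrightarrow> continuous_on SG f" and "u \<in> span E"
  shows "continuous_on SG (u :: plane \<Rightarrow> real)"
proof -
  have "subspace {f :: plane \<Rightarrow> real. continuous_on SG f}"
    unfolding subspace_def
    by (auto simp: zero_fun_def plus_fun_def scaleR_fun_def intro!: continuous_intros)
  with span_minimal[of E "{f. continuous_on SG f}"] assms show ?thesis by blast
qed

theorem theorem4p2:
  fixes m :: nat and \<mu> :: "plane measure" and E :: "(plane \<Rightarrow> real) set"
    and u v :: "plane \<Rightarrow> real"
  assumes "sg_measure \<mu>"
    and "initial_eigenbasis m E"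
    and "bandlimited E u" and "bandlimited E v"
  shows "(boundary_average m u = boundary_average m v \<longrightarrow> u = v) \<and>
         (integral_average \<mu> m u = integral_average \<mu> m v \<longrightarrow> u = v)"
proof -
  obtain B ext where B: "independent B" "E = ext ` B"
    "\<forall>b\<in>B. \<exists>lam. lam \<noteq> 6 \<and> neumann_eigenfunction m lam b \<and> decimation_extension m lam b (ext b)"
    using assms(2) unfolding initial_eigenbasis_def by blast
  then obtain lam where lam: "\<And>b. b \<in> B \<Longrightarrow> lam b \<noteq> 6 \<and> neumann_eigenfunction m (lam b) b"
    "\<And>b. b \<in> B \<Longrightarrow> decimation_extension m (lam b) b (ext b)"
    by metis
  have cont: "continuous_on SG (ext b)" if "b \<in> B" for b
    using lam(2)[OF that] by (simp add: decimation_extension_def)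
  have uv: "u \<in> span E" "v \<in> span E" using assms(3,4) by (simp_all add: bandlimited_def)
  then have "u - v \<in> span E" by (rule span_diff)
  then obtain t c' where t: "finite t" "t \<subseteq> E" "u - v = (\<Sum>e\<in>t. c' e *\<^sub>R e)"
    unfolding span_explicit by blast
  from t(2) have "\<exists>T\<subseteq>B. inj_on ext T \<and> t = ext ` T"
    unfolding B(2) subset_image_inj by blast
  then obtain T where T: "T \<subseteq> B" "inj_on ext T" "t = ext ` T"
    by blast
  define c where "c b = c' (ext b)" for b
  \<comment> \<open>The coefficients are moved from the extensions to the basis functions on level \<open>m\<close>,
    whose independence is known.\<close>
  have rep: "u - v = (\<Sum>b\<in>T. c b *\<^sub>R ext b)"
    using t(3) by (simp add: T(3) sum.reindex[OF T(2)] c_def)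
  have "finite T" using t(1) T(2,3) finite_imageD by blast
  note determined = coefficients_zero_if_cell_sums_zero[OF B(1) \<open>finite T\<close> T(1) lam(1)[OF subsetD[OF T(1)]]]
  have eq: "u = v" if "\<And>b. b \<in> T \<Longrightarrow> c b = 0"
    using rep that by simp
  have "u = v" if "boundary_average m u = boundary_average m v"
  proof (rule eq)
    fix b assume b: "b \<in> T"
    show "c b = 0"
    proof (rule determined[OF _ _ b])
      fix w assume w: "w \<in> sg_words m"
      have "cell_sum b w = cell_sum (ext b) w" if "b \<in> T" for b
        using cell_sum_cong[OF w decimation_extension_agrees[OF lam(2)]] that T(1) by fastforce
      then have "(\<Sum>b\<in>T. c b * cell_sum b w) = cell_sum (u - v) w"
        unfolding rep cell_sum_sum by simp
      also have "\<dots> = 0" using that w by (simp add: boundary_average_eq_iff)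
      finally show "(\<Sum>b\<in>T. c b * cell_sum b w) = 0" .
    qed 
  qed
  moreover have "u = v" if "integral_average \<mu> m u = integral_average \<mu> m v"
  proof (rule eq)
    have "\<forall>b\<in>T. \<exists>\<gamma>. \<gamma> \<noteq> 0 \<and> (\<forall>w\<in>sg_words m.
        3 * (3 ^ m * (LINT x:sg_cell w|\<mu>. ext b x)) = \<gamma> * cell_sum b w)"
    proof
      fix b assume "b \<in> T"
      then have "b \<in> B" using T(1) by blast
      then obtain \<gamma> where \<gamma>: "\<gamma> \<noteq> 0" "\<And>w. w \<in> sg_words m \<Longrightarrow>
          (\<lambda>k. (\<Sum>v\<in>sg_words k. cell_sum (ext b) (v @ w)) / 3 ^ k) \<longlonglongrightarrow> \<gamma> * cell_sum b w"
        using decimation_extension_cell_sums[OF lam(2)] by metis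
      have "3 * (3 ^ m * (LINT x:sg_cell w|\<mu>. ext b x)) = \<gamma> * cell_sum b w" if "w \<in> sg_words m" for w
        using LIMSEQ_unique[OF cell_averages_tendsto_integral[OF assms(1) that cont[OF \<open>b \<in> B\<close>]]
            \<gamma>(2)[OF that]] .
      with \<gamma>(1) show "\<exists>\<gamma>. \<gamma> \<noteq> 0 \<and> (\<forall>w\<in>sg_words m.
        3 * (3 ^ m * (LINT x:sg_cell w|\<mu>. ext b x)) = \<gamma> * cell_sum b w)" by blast
    qed
    then obtain \<gamma> where \<gamma>: "\<And>b. b \<in> T \<Longrightarrow> \<gamma> b \<noteq> 0"
      "\<And>b w. b \<in> T \<Longrightarrow> w \<in> sg_words m \<Longrightarrow>
         3 * (3 ^ m * (LINT x:sg_cell w|\<mu>. ext b x)) = \<gamma> b * cell_sum b w"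
      by metis
    have contE: "continuous_on SG u" "continuous_on SG v"
      using continuous_on_span[of E] cont uv unfolding B(2) by blast+
    fix b assume b: "b \<in> T"
    have "c b * \<gamma> b = 0"
    proof (rule determined[OF _ _ b])
      fix w assume w: "w \<in> sg_words m"
      have int: "set_integrable \<mu> (sg_cell w) (ext b)" if "b \<in> T" for b
        using set_integrable_cell[OF assms(1) cont w] T(1) that by blast
      have "(\<Sum>b\<in>T. c b * (LINT x:sg_cell w|\<mu>. ext b x)) =
          (LINT x:sg_cell w|\<mu>. (u - v) x)"
        unfolding rep sum_fun_apply set_lebesgue_integral_def scaleR_sum_right
        using int unfolding set_integrable_def
        by (subst Bochner_Integration.integral_sum) (simp_all add: mult.left_commute)
      also have "\<dots> = 0" by (rule integral_average_eqD[OF assms(1) contE that w])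
      finally have "0 = 3 * 3 ^ m * (\<Sum>b\<in>T. c b * (LINT x:sg_cell w|\<mu>. ext b x))" by simp
      also have "\<dots> = (\<Sum>b\<in>T. c b * (3 * (3 ^ m * (LINT x:sg_cell w|\<mu>. ext b x))))"
        by (simp add: sum_distrib_left mult_ac)
      also have "\<dots> = (\<Sum>b\<in>T. c b * \<gamma> b * cell_sum b w)"
        using \<gamma>(2)[OF _ w] by (simp add: mult.assoc)
      finally show "(\<Sum>b\<in>T. c b * \<gamma> b * cell_sum b w) = 0" by simp
    qed
    with \<gamma>(1)[OF b] show "c b = 0" by simp
  qed
  ultimately show ?thesis by blast
qed

end
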